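(* Let $M$ be a sapphire Sol $3$-manifold and let $\tau$ be a free involution on $M$. Then the triple $(M,\tau;\mathbb{R}^2)$ satisfies the Borsuk-Ulam property, i.e. for every continuous map $f:M\to\mathbb{R}^2$ there is a point $x\in M$ such that $f(x)=f(\tau(x))$.
   Context: Sapphire manifolds. For $i=1,2$ let $K_iI$ be a copy of the orientable twisted $I$-bundle over the Klein bottle, with $\pi_1(K_iI)=\langle a_i,b_i\mid a_ib_ia_i^{-1}b_i\rangle$; the boundary $\partial K_iI$ is a torus with $\pi_1(\partial K_iI)$ free abelian on $\alpha_i=a_i^2$ and $\beta_i=b_i$. For $A=\begin{pmatrix} r&s\\ t&u\end{pmatrix}\in GL_2(\mathbb{Z})$ let $\phi:\partial K_2I\to\partial K_1I$ be a homeomorphism with $\phi_\#(\alpha_2)=r\alpha_1+s\beta_1$ and $\phi_\#(\beta_2)=t\alpha_1+u\beta_1$. The sapphire determined by $A$ is the closed orientable $3$-manifold $S_A=K_1I\cup_\phi K_2I$. A sapphire Sol $3$-manifold is a manifold $S_A$ with all entries of $A$ nonzero ($rstu\neq 0$); these are exactly the sapphires with Sol geometry. A free involution on $M$ is a fixed-point-free homeomorphism $\tau:M\to M$ with $\tau^2=\mathrm{id}$. *)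

theory Defs
  imports "HOL-Analysis.Analysis"
begin

definition quotient_topology :: "'a topology \<Rightarrow> ('a \<times> 'a) set \<Rightarrow> 'a set topology" where
  "quotient_topology X R =
     topology (\<lambda>U. U \<subseteq> topspace X // R \<and> openin X {x \<in> topspace X. R `` {x} \<in> U})"

lemma istopology_quotient_topology:
  "istopology (\<lambda>U. U \<subseteq> topspace X // R \<and> openin X {x \<in> topspace X. R `` {x} \<in> U})"
proof -
  have 1: "{x \<in> topspace X. R `` {x} \<in> S \<inter> T} =
      {x \<in> topspace X. R `` {x} \<in> S} \<inter> {x \<in> topspace X. R `` {x} \<in> T}" for S T
    by auto
  have 2: "{x \<in> topspace X. R `` {x} \<in> \<Union>\<K>} = (\<Union>K\<in>\<K>. {x \<in> topspace X. R `` {x} \<in> K})" for \<K>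
    by auto
  show ?thesis
    unfolding istopology_def 1 2 by blast
qed

lemma openin_quotient_topology:
  "openin (quotient_topology X R) U \<longleftrightarrow>
     U \<subseteq> topspace X // R \<and> openin X {x \<in> topspace X. R `` {x} \<in> U}"
  by (simp add: quotient_topology_def istopology_quotient_topology)

lemma topspace_quotient_topology [simp]:
  "topspace (quotient_topology X R) = topspace X // R"
proof
  show "topspace (quotient_topology X R) \<subseteq> topspace X // R"
    using openin_quotient_topology openin_topspace by blast
  have "{x \<in> topspace X. R `` {x} \<in> topspace X // R} = topspace X"
    by (auto simp: quotient_def)
  then have "openin (quotient_topology X R) (topspace X // R)"
    by (simp add: openin_quotient_topology)
  then show "topspace X // R \<subseteq> topspace (quotient_topology X R)"
    by (rule openin_subset)
qed

lemma quotient_map_quotient_topology: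
  "quotient_map X (quotient_topology X R) (\<lambda>x. R `` {x})"
  by (auto simp: quotient_map_def openin_quotient_topology quotient_def)

text \<open>
  The orientable twisted I-bundle over the Klein bottle is the quotient of
  S^1 x S^1 x [-1,1] by the free, orientation-preserving involution
  (z, w, t) to (-z, cnj w, -t); its zero section t = 0 is the Klein bottle.
  On the universal cover R x R x [-1,1] (with z = cis (2 pi x), w = cis (2 pi y)) the
  deck group is generated by
    a (x, y, t) = (x + 1/2, -y, -t)   and   b (x, y, t) = (x, y + 1, t),
  so that a b a^(-1) b = 1 and a^2 is the translation of x by 1.
\<close>

definition TI :: "(complex \<times> complex \<times> real) set" where
  "TI = sphere 0 1 \<times> sphere 0 1 \<times> {-1..1}"

definition KI_rel :: "((complex \<times> complex \<times> real) \<times> (complex \<times> complex \<times> real)) set" where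
  "KI_rel = {((z, w, t), p). (z, w, t) \<in> TI \<and> (p = (z, w, t) \<or> p = (- z, cnj w, - t))}"

definition KI :: "(complex \<times> complex \<times> real) set topology" where
  "KI = quotient_topology (top_of_set TI) KI_rel"

definition KI_boundary :: "(complex \<times> complex \<times> real) set set" where
  "KI_boundary = (\<lambda>p. KI_rel `` {p}) ` (sphere 0 1 \<times> sphere 0 1 \<times> {-1, 1})"

lemma equiv_KI_rel: "equiv TI KI_rel"
  by (auto simp: equiv_def refl_on_def sym_def trans_def KI_rel_def TI_def)

text \<open>
  Every boundary point has exactly one representative with t = 1, so the boundary is a torus.
  The loop below lifts to the path from (0, 0, 1) to (m, n, 1) in the universal cover and
  represents m alpha + n beta, where alpha = a^2 and beta = b.
\<close>

definition boundary_loop :: "int \<Rightarrow> int \<Rightarrow> real \<Rightarrow> (complex \<times> complex \<times> real) set" where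
  "boundary_loop m n = (\<lambda>\<theta>. KI_rel `` {(cis (2 * pi * m * \<theta>), cis (2 * pi * n * \<theta>), 1)})"

text \<open>
  The fundamental group of a torus is abelian, so its elements are the free homotopy
  classes of loops and no base points are needed for the induced homomorphism.
\<close>

definition freely_homotopic_loops :: "'a topology \<Rightarrow> (real \<Rightarrow> 'a) \<Rightarrow> (real \<Rightarrow> 'a) \<Rightarrow> bool" where
  "freely_homotopic_loops X = homotopic_with (\<lambda>\<gamma>. \<gamma> 1 = \<gamma> 0) (top_of_set {0..1}) X"

definition sapphire_gluing ::
  "int^2^2 \<Rightarrow> ((complex \<times> complex \<times> real) set \<Rightarrow> (complex \<times> complex \<times> real) set) \<Rightarrow> bool" where
  "sapphire_gluing A \<phi> \<longleftrightarrow>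
     homeomorphic_map (subtopology KI KI_boundary) (subtopology KI KI_boundary) \<phi> \<and>
     freely_homotopic_loops (subtopology KI KI_boundary)
       (\<phi> \<circ> boundary_loop 1 0) (boundary_loop (A $ 1 $ 1) (A $ 1 $ 2)) \<and>
     freely_homotopic_loops (subtopology KI KI_boundary)
       (\<phi> \<circ> boundary_loop 0 1) (boundary_loop (A $ 2 $ 1) (A $ 2 $ 2))"

definition attach_rel :: "('a \<Rightarrow> 'a) \<Rightarrow> 'a topology \<Rightarrow> 'a set \<Rightarrow> ((nat \<times> 'a) \<times> (nat \<times> 'a)) set" where
  "attach_rel \<phi> X B =
     Id_on ({1, 2} \<times> topspace X) \<union> {((2, x), (1, \<phi> x)) | x. x \<in> B} \<union> {((1, \<phi> x), (2, x)) | x. x \<in> B}"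

lemma equiv_attach_rel:
  assumes "B \<subseteq> topspace X" "inj_on \<phi> B" "\<phi> ` B \<subseteq> topspace X"
  shows "equiv ({1, 2} \<times> topspace X) (attach_rel \<phi> X B)"
proof -
  have "refl_on ({1, 2} \<times> topspace X) (attach_rel \<phi> X B)"
    by (auto simp: refl_on_def attach_rel_def)
  moreover have "attach_rel \<phi> X B \<subseteq> ({1, 2} \<times> topspace X) \<times> ({1, 2} \<times> topspace X)"
    using assms by (auto simp: attach_rel_def)
  moreover have "sym (attach_rel \<phi> X B)"
    by (auto simp: sym_def attach_rel_def)
  moreover have "trans (attach_rel \<phi> X B)"
    using assms by (auto simp: trans_def attach_rel_def inj_on_def)
  ultimately show ?thesis
    by (auto simp: equiv_def)
qed

definition sapphire_space ::
  "((complex \<times> complex \<times> real) set \<Rightarrow> (complex \<times> complex \<times> real) set) \<Rightarrow>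
     (nat \<times> (complex \<times> complex \<times> real) set) set topology" where
  "sapphire_space \<phi> =
     quotient_topology (sum_topology (\<lambda>_. KI) {1, 2}) (attach_rel \<phi> KI KI_boundary)"

text \<open>Up to homeomorphism the sapphire depends only on A, not on the choice of the gluing map.\<close>

definition is_sapphire :: "int^2^2 \<Rightarrow> 'a topology \<Rightarrow> bool" where
  "is_sapphire A M \<longleftrightarrow> (\<exists>\<phi>. sapphire_gluing A \<phi> \<and> M homeomorphic_space sapphire_space \<phi>)"

definition sapphire_Sol_manifold :: "'a topology \<Rightarrow> bool" where
  "sapphire_Sol_manifold M \<longleftrightarrow>
     (\<exists>A::int^2^2. invertible A \<and> (\<forall>i j. A $ i $ j \<noteq> 0) \<and> is_sapphire A M)"

definition free_involution :: "'a topology \<Rightarrow> ('a \<Rightarrow> 'a) \<Rightarrow> bool" where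
  "free_involution M \<tau> \<longleftrightarrow>
     homeomorphic_map M M \<tau> \<and> (\<forall>x\<in>topspace M. \<tau> (\<tau> x) = x \<and> \<tau> x \<noteq> x)"

definition Borsuk_Ulam_property :: "'a topology \<Rightarrow> ('a \<Rightarrow> 'a) \<Rightarrow> 'b topology \<Rightarrow> bool" where
  "Borsuk_Ulam_property M \<tau> N \<longleftrightarrow>
     (\<forall>f. continuous_map M N f \<longrightarrow> (\<exists>x\<in>topspace M. f x = f (\<tau> x)))"

end

theory Submission
  imports Defs "HOL-Library.Real_Mod"
begin

text \<open>
  If f separated every pair x, \<tau> x, then h x = (f x - f (\<tau> x)) / |f x - f (\<tau> x)| would be a map to
  the circle with h (\<tau> x) = - h x. A real-valued angle L of h is impossible on a connected
  space, since L \<circ> \<tau> - L is odd under \<tau> and never zero. On a sapphire Sol manifold every circle map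
  has an angle, because the first Betti number vanishes: on each piece the relation a b a^(-1) b = 1
  kills the degree along b, and then the gluing with t \<noteq> 0 and r \<noteq> 0 kills the
  degrees along a_1 and a_2.
\<close>

section \<open>Angles of circle-valued maps\<close>

text \<open>The solutions of \<open>cis v = 1\<close> form the countable set 2 pi Z, while a
  connected set of reals with two points is uncountable.\<close>

lemma connected_cis_eq_1:
  assumes "connected T" and "\<And>v. v \<in> T \<Longrightarrow> cis v = 1"
  shows "\<exists>k::int. T \<subseteq> {2 * pi * k}"
proof -
  have sub: "T \<subseteq> range (\<lambda>k::int. 2 * pi * k)"
    using assms(2) by (fastforce simp: cis_eq_1_iff)
  then have "countable T"
    by (rule countable_subset) simp
  then have "\<exists>v. T \<subseteq> {v}"
    using connected_uncountable[OF assms(1)] by blast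
  with sub show ?thesis by blast
qed

text \<open>This is uniqueness of lifts through the covering \<open>cis\<close> of the circle: the
  difference of the two angles is continuous with values in the discrete set 2 pi Z. The integers
  attached below to deck transformations and to the gluing torus come from here.\<close>

lemma angles_differ_by_constant:
  assumes "connected_space X" "continuous_map X euclideanreal u" "continuous_map X euclideanreal v"
    and "\<And>x. x \<in> topspace X \<Longrightarrow> cis (u x) = cis (v x)"
  shows "\<exists>k::int. \<forall>x\<in>topspace X. u x = v x + 2 * pi * k"
proof -
  have "continuous_map X euclideanreal (\<lambda>x. u x - v x)"
    using assms(2,3) by (intro continuous_intros)
  then have "connected ((\<lambda>x. u x - v x) ` topspace X)"
    using connectedin_continuous_map_image[of X euclideanreal _ "topspace X"] assms(1)
    by (simp add: connectedin_topspace)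
  moreover have "cis (u x - v x) = 1" if "x \<in> topspace X" for x
    using assms(4)[OF that] by (simp add: cis_divide[symmetric])
  ultimately obtain k :: int where "(\<lambda>x. u x - v x) ` topspace X \<subseteq> {2 * pi * k}"
    using connected_cis_eq_1 by (metis (no_types, lifting) imageE)
  then show ?thesis
    by (intro exI[of _ k]) (fastforce simp: algebra_simps image_subset_iff)
qed

text \<open>A nowhere vanishing function on a contractible set has a continuous logarithm. Norm 1
  makes the logarithm purely imaginary, and its imaginary part is the angle.\<close>

lemma contractible_angle:
  fixes f :: "'a::real_normed_vector \<Rightarrow> complex"
  assumes "contractible S" "continuous_on S f" "\<And>x. x \<in> S \<Longrightarrow> norm (f x) = 1"
  shows "\<exists>\<theta>. continuous_on S \<theta> \<and> (\<forall>x\<in>S. f x = cis (\<theta> x))"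
proof -
  obtain g where g: "continuous_on S g" "\<And>x. x \<in> S \<Longrightarrow> f x = exp (g x)"
    using continuous_logarithm_on_contractible[OF assms(2,1)] assms(3)
    by (metis norm_zero zero_neq_one)
  have "f x = cis (Im (g x))" if "x \<in> S" for x
  proof -
    have "exp (Re (g x)) = 1"
      using g(2)[OF that] assms(3)[OF that] by simp
    then have "Re (g x) = 0" by simp
    then have "g x = \<i> * Im (g x)" by (simp add: complex_eq_iff)
    then show ?thesis
      using g(2)[OF that] by (metis cis_conv_exp)
  qed
  moreover have "continuous_on S (\<lambda>x. Im (g x))"
    using g(1) by (intro continuous_intros)
  ultimately show ?thesis by blast
qed

text \<open>Homotopy invariance of the winding number: \<open>u 1 - u 0\<close> is 2 pi times the
  degree of \<open>h\<close> along \<gamma>. The square that parametrizes the homotopy is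
  contractible, so one angle \<theta> serves all intermediate loops.\<close>

lemma freely_homotopic_loops_angle:
  assumes hom: "freely_homotopic_loops Y \<gamma> \<delta>"
    and h: "continuous_map Y euclidean h" "\<And>y. y \<in> topspace Y \<Longrightarrow> norm (h y) = 1"
    and u: "continuous_on {0..1} u" "\<And>s. s \<in> {0..1} \<Longrightarrow> h (\<gamma> s) = cis (u s)"
    and v: "continuous_on {0..1} v" "\<And>s. s \<in> {0..1} \<Longrightarrow> h (\<delta> s) = cis (v s)"
  shows "u 1 - u 0 = v 1 - v 0"
proof -
  let ?I = "{0..1::real}"
  obtain H where H: "continuous_map (prod_topology (top_of_set ?I) (top_of_set ?I)) Y H"
    "\<And>s. H (0, s) = \<gamma> s" "\<And>s. H (1, s) = \<delta> s" "\<And>t. t \<in> ?I \<Longrightarrow> H (t, 1) = H (t, 0)"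
    using hom unfolding freely_homotopic_loops_def homotopic_with_def by metis
  have H': "continuous_map (top_of_set (?I \<times> ?I)) Y H"
    using H(1) by (simp add: prod_topology_subtopology_eu)
  have "continuous_map (top_of_set (?I \<times> ?I)) euclidean (h \<circ> H)"
    by (rule continuous_map_compose[OF H' h(1)])
  then have c: "continuous_on (?I \<times> ?I) (h \<circ> H)" by simp
  have n: "norm ((h \<circ> H) p) = 1" if "p \<in> ?I \<times> ?I" for p
    using h(2) continuous_map_funspace[OF H'] that by (auto simp: Pi_iff)
  obtain \<theta> where \<theta>: "continuous_on (?I \<times> ?I) \<theta>" "\<And>p. p \<in> ?I \<times> ?I \<Longrightarrow> h (H p) = cis (\<theta> p)"
    using contractible_angle[OF _ c n] convex_imp_contractible[OF convex_Times[of ?I ?I]] by auto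
  \<comment> \<open>On a vertical side of the square any other angle differs from \<theta> by a
    constant, which cancels in the increments \<open>u 1 - u 0\<close> and
    \<open>v 1 - v 0\<close>.\<close>
  have side: "\<exists>k::int. \<forall>s\<in>?I. \<theta> (t, s) = w s + 2 * pi * k"
    if "t \<in> ?I" "continuous_on ?I w" "\<And>s. s \<in> ?I \<Longrightarrow> h (H (t, s)) = cis (w s)" for t w
  proof -
    have "continuous_on ?I (\<lambda>s. \<theta> (t, s))"
      by (rule continuous_on_compose2[OF \<theta>(1)]) (use that in \<open>auto intro!: continuous_intros\<close>)
    then show ?thesis
      using angles_differ_by_constant[of "top_of_set ?I" "\<lambda>s. \<theta> (t, s)" w] that \<theta>(2)
      by (auto simp: connected_space_subtopology)
  qed
  \<comment> \<open>Each stage of the homotopy is a closed loop, so the increment of \<theta> along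
    it lies in 2 pi Z and cannot vary with \<open>t\<close>.\<close>
  have "\<exists>k::int. \<forall>t\<in>?I. \<theta> (t, 1) = \<theta> (t, 0) + 2 * pi * k"
  proof -
    have "continuous_on ?I (\<lambda>t. \<theta> (t, s))" if "s \<in> ?I" for s
      by (rule continuous_on_compose2[OF \<theta>(1)]) (use that in \<open>auto intro!: continuous_intros\<close>)
    moreover have "cis (\<theta> (t, 1)) = cis (\<theta> (t, 0))" if "t \<in> ?I" for t
      using \<theta>(2)[of "(t, 1)"] \<theta>(2)[of "(t, 0)"] H(4)[OF that] that by simp
    ultimately show ?thesis
      using angles_differ_by_constant[of "top_of_set ?I" "\<lambda>t. \<theta> (t, 1)" "\<lambda>t. \<theta> (t, 0)"]
      by (simp add: connected_space_subtopology)
  qed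
  then have eq: "\<theta> (0, 1) - \<theta> (0, 0) = \<theta> (1, 1) - \<theta> (1, 0)" by auto
  have "\<exists>k::int. \<forall>s\<in>?I. \<theta> (0, s) = u s + 2 * pi * k" "\<exists>k::int. \<forall>s\<in>?I. \<theta> (1, s) = v s + 2 * pi * k"
    using side[of 0 u] side[of 1 v] u v H(2,3) by auto
  with eq show ?thesis by auto
qed

section \<open>The twisted I-bundle over the Klein bottle\<close>

text \<open>The universal covering map. Angles are measured in full turns, so that deck
  transformations shift \<open>x\<close> by half-integers and \<open>y\<close> by integers.\<close>

definition KI_cover :: "real \<times> real \<times> real \<Rightarrow> (complex \<times> complex \<times> real) set" where
  "KI_cover = (\<lambda>(x, y, t). KI_rel `` {(cis (2 * pi * x), cis (2 * pi * y), t)})"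

lemma KI_rel_class_eq_iff:
  assumes "(z, w, t) \<in> TI" "(z', w', t') \<in> TI"
  shows "KI_rel `` {(z, w, t)} = KI_rel `` {(z', w', t')} \<longleftrightarrow>
    (z', w', t') = (z, w, t) \<or> (z', w', t') = (- z, cnj w, - t)"
  using eq_equiv_class_iff[OF equiv_KI_rel assms] assms(1) by (auto simp: KI_rel_def)

lemma cis_in_TI: "t \<in> {-1..1} \<Longrightarrow> (cis x, cis y, t) \<in> TI"
  by (simp add: TI_def)

text \<open>The fibres are the orbits of the deck group. Each factor a adds half a turn in
  \<open>x\<close> and flips \<open>y\<close> and \<open>t\<close>, so the first alternative
  collects the words with an even exponent sum of a and the second those with an odd one.\<close>

lemma KI_cover_eq_iff:
  assumes "t \<in> {-1..1}" "t' \<in> {-1..1}"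
  shows "KI_cover (x, y, t) = KI_cover (x', y', t') \<longleftrightarrow>
    (\<exists>(m::int) (n::int). (x', y', t') = (x + m, y + n, t) \<or> (x', y', t') = (x + m + 1/2, - y + n, - t))"
proof -
  have cis_eq: "cis (2 * pi * a) = cis (2 * pi * b) \<longleftrightarrow> (\<exists>m::int. a = b + m)" for a b
  proof -
    have "cis (2 * pi * a) = cis (2 * pi * b) \<longleftrightarrow> cis (2 * pi * a - 2 * pi * b) = 1"
      by (simp add: cis_divide[symmetric])
    also have "\<dots> \<longleftrightarrow> (\<exists>m::int. 2 * pi * (a - b) = 2 * pi * m)"
      by (simp add: cis_eq_1_iff algebra_simps)
    also have "\<dots> \<longleftrightarrow> (\<exists>m::int. a - b = m)"
      by simp
    finally show ?thesis by (simp add: diff_eq_eq add.commute)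
  qed
  \<comment> \<open>The sign change of z is half a turn in \<open>x\<close>; likewise conjugating w
    negates \<open>y\<close>.\<close>
  have neg: "- cis (2 * pi * x) = cis (2 * pi * (x + 1/2))"
    by (simp add: distrib_left cis_mult[symmetric])
  have "KI_cover (x, y, t) = KI_cover (x', y', t') \<longleftrightarrow>
     (cis (2 * pi * x') = cis (2 * pi * x) \<and> cis (2 * pi * y') = cis (2 * pi * y) \<and> t' = t) \<or>
     (cis (2 * pi * x') = - cis (2 * pi * x) \<and> cis (2 * pi * y') = cnj (cis (2 * pi * y)) \<and> t' = - t)"
    unfolding KI_cover_def using KI_rel_class_eq_iff[OF cis_in_TI[OF assms(1)] cis_in_TI[OF assms(2)]]
    by simp
  also have "\<dots> \<longleftrightarrow>
     (cis (2 * pi * x') = cis (2 * pi * x) \<and> cis (2 * pi * y') = cis (2 * pi * y) \<and> t' = t) \<or>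
     (cis (2 * pi * x') = cis (2 * pi * (x + 1/2)) \<and> cis (2 * pi * y') = cis (2 * pi * (- y)) \<and> t' = - t)"
    by (simp only: neg) (simp add: cis_cnj)
  also have "\<dots> \<longleftrightarrow>
    (\<exists>(m::int) (n::int). (x', y', t') = (x + m, y + n, t) \<or> (x', y', t') = (x + m + 1/2, - y + n, - t))"
    unfolding cis_eq by (auto simp: algebra_simps)
  finally show ?thesis .
qed

section \<open>The universal cover as a quotient map\<close>

lemma quotient_map_KI: "quotient_map (top_of_set TI) KI (\<lambda>p. KI_rel `` {p})"
  unfolding KI_def by (rule quotient_map_quotient_topology)

abbreviation KI_strip :: "(real \<times> real \<times> real) set" where
  "KI_strip \<equiv> UNIV \<times> UNIV \<times> {-1..1}"

abbreviation KI_box :: "(real \<times> real \<times> real) set" where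
  "KI_box \<equiv> {0..1} \<times> {0..1} \<times> {-1..1}"

lemma continuous_map_KI_cover: "continuous_map (top_of_set KI_strip) KI KI_cover"
proof -
  let ?e = "\<lambda>(x, y, t). (cis (2 * pi * x), cis (2 * pi * y), t)"
  have "continuous_on KI_strip ?e"
    unfolding case_prod_unfold by (intro continuous_intros)
  then have "continuous_map (top_of_set KI_strip) (top_of_set TI) ?e"
    by (auto simp: cis_in_TI)
  then have "continuous_map (top_of_set KI_strip) KI ((\<lambda>p. KI_rel `` {p}) \<circ> ?e)"
    by (rule continuous_map_compose[OF _ quotient_imp_continuous_map[OF quotient_map_KI]])
  moreover have "(\<lambda>p. KI_rel `` {p}) \<circ> ?e = KI_cover"
    by (auto simp: KI_cover_def)
  ultimately show ?thesis by simp
qed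

text \<open>The box meets every deck orbit, and it is compact while \<open>TI\<close> is Hausdorff,
  so the covering restricted to it is a quotient map. A continuous function on the box that is
  constant on fibres therefore descends to \<open>KI\<close>.\<close>

lemma quotient_map_KI_cover: "quotient_map (top_of_set KI_box) KI KI_cover"
proof -
  let ?e = "\<lambda>(x, y, t). (cis (2 * pi * x), cis (2 * pi * y), t)"
  have circle: "\<exists>x\<in>{0..1}. cis (2 * pi * x) = z" if "norm z = 1" for z
  proof -
    have "cis (Arg2pi z) = z"
      using that by (simp add: complex_norm_eq_1_exp cis_conv_exp)
    then show ?thesis
      using Arg2pi[of z] by (intro bexI[of _ "Arg2pi z / (2 * pi)"]) auto
  qed
  have "continuous_on KI_box ?e"
    unfolding case_prod_unfold by (intro continuous_intros)
  then have c: "continuous_map (top_of_set KI_box) (top_of_set TI) ?e"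
    by (auto simp: cis_in_TI)
  have "TI \<subseteq> ?e ` KI_box"
  proof
    fix p assume "p \<in> TI"
    then obtain z w t where p: "p = (z, w, t)" "norm z = 1" "norm w = 1" "t \<in> {-1..1}"
      by (auto simp: TI_def)
    then obtain x y where "x \<in> {0..1}" "y \<in> {0..1}" "cis (2 * pi * x) = z" "cis (2 * pi * y) = w"
      using circle by meson
    then show "p \<in> ?e ` KI_box"
      using p by (intro image_eqI[of _ _ "(x, y, t)"]) auto
  qed
  then have "?e ` KI_box = TI"
    by (auto simp: cis_in_TI)
  moreover have "compact KI_box"
    by (intro compact_Times) auto
  ultimately have "quotient_map (top_of_set KI_box) (top_of_set TI) ?e"
    using c by (intro continuous_imp_quotient_map)
      (auto simp: compact_space_subtopology Hausdorff_space_subtopology)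
  then have "quotient_map (top_of_set KI_box) KI ((\<lambda>p. KI_rel `` {p}) \<circ> ?e)"
    using quotient_map_KI by (rule quotient_map_compose)
  moreover have "(\<lambda>p. KI_rel `` {p}) \<circ> ?e = KI_cover"
    by (auto simp: KI_cover_def)
  ultimately show ?thesis by simp
qed

lemma connected_space_KI: "connected_space KI"
proof -
  have "connected KI_box"
    by (intro connected_Times) auto
  then show ?thesis
    using connected_space_quotient_map_image[OF quotient_map_KI_cover]
    by (simp add: connected_space_subtopology)
qed

section \<open>The boundary torus\<close>

lemma boundary_loop_eq: "boundary_loop m n s = KI_cover (m * s, n * s, 1)"
  by (simp add: boundary_loop_def KI_cover_def mult.assoc)

text \<open>The involution exchanges the ends t = -1 and t = 1, so a boundary point given at t = -1
  has a second representative at t = 1.\<close>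

lemma KI_boundary_eq: "KI_boundary = KI_cover ` (UNIV \<times> UNIV \<times> {1})"
proof
  show "KI_cover ` (UNIV \<times> UNIV \<times> {1}) \<subseteq> KI_boundary"
    by (auto simp: KI_cover_def KI_boundary_def intro!: imageI)
next
  show "KI_boundary \<subseteq> KI_cover ` (UNIV \<times> UNIV \<times> {1})"
  proof
    fix c assume "c \<in> KI_boundary"
    then obtain z w t where zwt: "c = KI_rel `` {(z, w, t)}" "norm z = 1" "norm w = 1" "t \<in> {-1, 1}"
      by (auto simp: KI_boundary_def)
    have "\<exists>z w. norm z = 1 \<and> norm w = 1 \<and> c = KI_rel `` {(z, w, 1)}"
    proof (cases "t = 1")
      case False
      then have "c = KI_rel `` {(- z, cnj w, 1)}"
        using zwt KI_rel_class_eq_iff[of z w t "- z" "cnj w" 1] by (auto simp: TI_def)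
      then show ?thesis using zwt by (metis complex_mod_cnj norm_minus_cancel)
    qed (use zwt in blast)
    then obtain z w where zw: "norm z = 1" "norm w = 1" "c = KI_rel `` {(z, w, 1)}" by blast
    have "z = cis (2 * pi * (Arg z / (2 * pi)))" "w = cis (2 * pi * (Arg w / (2 * pi)))"
      using zw cis_Arg[of z] cis_Arg[of w] by (fastforce simp: sgn_eq)+
    then have "c = KI_cover (Arg z / (2 * pi), Arg w / (2 * pi), 1)"
      using zw(3) by (simp add: KI_cover_def)
    then show "c \<in> KI_cover ` (UNIV \<times> UNIV \<times> {1})" by blast
  qed
qed

lemma KI_boundary_nonempty: "KI_boundary \<noteq> {}"
  by (simp add: KI_boundary_eq)

lemma KI_boundary_subset: "KI_boundary \<subseteq> topspace KI"
  using continuous_map_image_subset_topspace[OF continuous_map_KI_cover] by (force simp: KI_boundary_eq)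

text \<open>The boundary is the image of a plane. Its connectedness later makes two angles along the
  gluing torus differ by one single constant.\<close>

lemma connectedin_KI_boundary: "connectedin KI KI_boundary"
proof -
  have "connected (UNIV \<times> UNIV \<times> {1::real} :: (real \<times> real \<times> real) set)"
    by (intro connected_Times) auto
  then have "connectedin (top_of_set KI_strip) (UNIV \<times> UNIV \<times> {1})"
    by (auto simp: connectedin_subtopology)
  then show ?thesis
    unfolding KI_boundary_eq by (rule connectedin_continuous_map_image[OF continuous_map_KI_cover])
qed

text \<open>
  The integer k is the value on a of the homomorphism from the fundamental group of KI to the
  integers that h induces; on a^2 it is 2 k and on b it is 0.
\<close>

lemma KI_circle_map:
  assumes h: "continuous_map KI euclidean h" "\<And>x. x \<in> topspace KI \<Longrightarrow> norm (h x) = 1"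
  shows "\<exists>k::int.
    (\<forall>m n. \<exists>u. continuous_on {0..1} u \<and> (\<forall>s\<in>{0..1}. h (boundary_loop m n s) = cis (u s)) \<and>
       u 1 - u 0 = 4 * pi * of_int k * of_int m) \<and>
    (k = 0 \<longrightarrow> (\<exists>L. continuous_map KI euclideanreal L \<and> (\<forall>x\<in>topspace KI. h x = cis (L x))))"
proof -
  have "continuous_map (top_of_set KI_strip) euclidean (h \<circ> KI_cover)"
    by (rule continuous_map_compose[OF continuous_map_KI_cover h(1)])
  then have c: "continuous_on KI_strip (h \<circ> KI_cover)" by simp
  have "norm ((h \<circ> KI_cover) p) = 1" if "p \<in> KI_strip" for p
    using h(2) continuous_map_image_subset_topspace[OF continuous_map_KI_cover] that by force
  moreover have conv: "convex KI_strip"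
    by (intro convex_Times) auto
  \<comment> \<open>The strip is convex, so the lift of \<open>h\<close> to the universal cover has
    a global angle \<theta>.\<close>
  ultimately obtain \<theta> where \<theta>: "continuous_on KI_strip \<theta>"
    "\<And>p. p \<in> KI_strip \<Longrightarrow> h (KI_cover p) = cis (\<theta> p)"
    using contractible_angle[OF convex_imp_contractible[OF conv] c] by auto
  \<comment> \<open>A deck transformation does not change the lifted map, so it changes \<theta> by
    a constant; the integer \<open>k\<close> is the value of the induced homomorphism on it.\<close>
  have deck: "\<exists>k::int. \<forall>p\<in>KI_strip. \<theta> (T p) = \<theta> p + 2 * pi * k"
    if "continuous_on KI_strip T" "\<And>p. p \<in> KI_strip \<Longrightarrow> T p \<in> KI_strip"
      "\<And>p. p \<in> KI_strip \<Longrightarrow> KI_cover (T p) = KI_cover p" for T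
  proof -
    have "continuous_on KI_strip (\<lambda>p. \<theta> (T p))"
      by (rule continuous_on_compose2[OF \<theta>(1)]) (use that in blast)+
    moreover have "cis (\<theta> (T p)) = cis (\<theta> p)" if "p \<in> KI_strip" for p
      using \<theta>(2) \<open>p \<in> KI_strip\<close> \<open>\<And>p. p \<in> KI_strip \<Longrightarrow> T p \<in> KI_strip\<close>
        \<open>\<And>p. p \<in> KI_strip \<Longrightarrow> KI_cover (T p) = KI_cover p\<close> by metis
    ultimately show ?thesis
      using angles_differ_by_constant[of "top_of_set KI_strip" "\<lambda>p. \<theta> (T p)" \<theta>] \<theta>(1)
        convex_connected[OF conv] by (simp add: connected_space_subtopology)
  qed
  let ?a = "\<lambda>(x, y, t). (x + 1/2, - y, - t) :: real \<times> real \<times> real"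
  let ?b = "\<lambda>(x, y, t). (x, y + 1, t) :: real \<times> real \<times> real"
  have "KI_cover (?a p) = KI_cover p" if "p \<in> KI_strip" for p
  proof -
    obtain x y t where p: "p = (x, y, t)" by (cases p)
    have "KI_cover (x, y, t) = KI_cover (x + 1/2, - y, - t)"
      using that unfolding p
      by (subst KI_cover_eq_iff) (auto intro: exI[of _ "0::int"])
    then show ?thesis unfolding p by simp
  qed
  moreover have "continuous_on KI_strip ?a"
    unfolding case_prod_unfold by (intro continuous_intros)
  ultimately obtain k :: int where k: "\<And>p. p \<in> KI_strip \<Longrightarrow> \<theta> (?a p) = \<theta> p + 2 * pi * k"
    using deck[of ?a] by auto
  have "KI_cover (?b p) = KI_cover p" if "p \<in> KI_strip" for p
  proof -
    obtain x y t where p: "p = (x, y, t)" by (cases p)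
    have "KI_cover (x, y, t) = KI_cover (x, y + 1, t)"
      using that unfolding p
      by (subst KI_cover_eq_iff) (auto intro: exI[of _ "0::int"] exI[of _ "1::int"])
    then show ?thesis unfolding p by simp
  qed
  moreover have "continuous_on KI_strip ?b"
    unfolding case_prod_unfold by (intro continuous_intros)
  ultimately obtain l :: int where l: "\<And>p. p \<in> KI_strip \<Longrightarrow> \<theta> (?b p) = \<theta> p + 2 * pi * l"
    using deck[of ?b] by auto
  have a: "\<theta> (x + 1/2, - y, - t) = \<theta> (x, y, t) + 2 * pi * k" if "t \<in> {-1..1}" for x y t
    using k[of "(x, y, t)"] that by simp
  have b: "\<theta> (x, y + 1, t) = \<theta> (x, y, t) + 2 * pi * l" if "t \<in> {-1..1}" for x y t
    using l[of "(x, y, t)"] that by simp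
  \<comment> \<open>The relation in the form b a b = a, evaluated at the origin: a leads to (1/2, 0,
    0) with increment 2 pi k, and b, then a, then b leads to the same point with increment 2 pi (k +
    2 l).\<close>
  have "l = 0"
    using a[of 0 0 0] a[of 0 0 1] b[of 0 0 0] b[of 0 "1/2" "-1"] by simp
  \<comment> \<open>Applying a twice cancels the flips of \<open>y\<close> and \<open>t\<close> and
    leaves the unit translation of \<open>x\<close>.\<close>
  have step: "\<theta> (x + 1, y, t) = \<theta> (x, y, t) + 4 * pi * k" if "t \<in> {-1..1}" for x y t
    using a[of "- t" "x + 1/2" "- y"] a[OF that, of x y] that
    by (simp add: add.commute)
  have m: "\<theta> (x + real_of_int m, y, t) = \<theta> (x, y, t) + 4 * pi * k * m" if "t \<in> {-1..1}" for m x y t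
  proof (induction m rule: int_induct[where k = 0])
    case (step1 i)
    then show ?case
      using step[OF that, of "x + i" y] by (simp add: algebra_simps)
  next
    case (step2 i)
    then show ?case
      using step[OF that, of "x + (i - 1)" y] by (simp add: algebra_simps)
  qed simp
  have n: "\<theta> (x, y + real_of_int n, t) = \<theta> (x, y, t)" if "t \<in> {-1..1}" for n x y t
  proof (induction n rule: int_induct[where k = 0])
    case (step1 i)
    then show ?case
      using b[OF that, of x "y + i"] \<open>l = 0\<close> by (simp add: algebra_simps)
  next
    case (step2 i)
    then show ?case
      using b[OF that, of x "y + (i - 1)"] \<open>l = 0\<close> by (simp add: algebra_simps)
  qed simp
  have angles: "\<exists>u. continuous_on {0..1} u \<and> (\<forall>s\<in>{0..1}. h (boundary_loop i j s) = cis (u s)) \<and>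
       u 1 - u 0 = 4 * pi * k * i" for i j
  proof (intro exI conjI ballI)
    \<comment> \<open>The boundary loop lifts to a straight segment in the plane t = 1, and \<theta>
      along this segment is an angle of \<open>h\<close> along the loop.\<close>
    let ?u = "\<lambda>s::real. \<theta> (of_int i * s, of_int j * s, 1)"
    show "continuous_on {0..1} ?u"
      by (rule continuous_on_compose2[OF \<theta>(1)]) (auto intro!: continuous_intros)
    show "h (boundary_loop i j s) = cis (?u s)" if "s \<in> {0..1}" for s
      by (simp add: boundary_loop_eq \<theta>(2))
    show "?u 1 - ?u 0 = 4 * pi * k * i"
      using m[of 1 0 i j] n[of 1 0 0 j] by simp
  qed
  have lift: "\<exists>L. continuous_map KI euclideanreal L \<and> (\<forall>x\<in>topspace KI. h x = cis (L x))" if "k = 0"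
  proof -
    \<comment> \<open>For \<open>k = 0\<close> the function \<theta> is invariant under both
      generators a and b, hence constant on deck orbits, and so it descends to
      \<open>KI\<close>.\<close>
    have fibre: "\<theta> p = \<theta> q" if in_box: "p \<in> KI_box" "q \<in> KI_box" and eq: "KI_cover p = KI_cover q" for p q
    proof -
      obtain x y t x' y' t' where pq: "p = (x, y, t)" "q = (x', y', t')" by (metis prod_cases3)
      then have t: "t \<in> {-1..1}" "t' \<in> {-1..1}" using in_box by auto
      obtain i j :: int where
        "(x', y', t') = (x + i, y + j, t) \<or> (x', y', t') = (x + i + 1/2, - y + j, - t)"
        using eq unfolding pq KI_cover_eq_iff[OF t] by blast
      then show ?thesis
      proof
        assume "(x', y', t') = (x + i, y + j, t)"
        then show ?thesis
          unfolding pq using m[OF t(1)] n[OF t(1)] \<open>k = 0\<close> by simp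
      next
        assume *: "(x', y', t') = (x + i + 1/2, - y + j, - t)"
        \<comment> \<open>The point is reached from \<open>(x, y, t)\<close> by translating
          \<open>x\<close> by \<open>i\<close>, applying a, and translating \<open>y\<close> by
          \<open>j\<close>.\<close>
        have "\<theta> (x + i + 1/2, - y + j, - t) = \<theta> (x, y, t)"
          using n[of "-t" "x + i + 1/2" "- y" j] a[OF t(1), of "x + i" y] m[OF t(1), of x i y] t \<open>k = 0\<close>
          by simp
        then show ?thesis
          unfolding pq * by simp
      qed
    qed
    have cont: "continuous_map (top_of_set KI_box) euclideanreal \<theta>"
      using continuous_on_subset[OF \<theta>(1), of KI_box] by auto
    obtain L where L: "continuous_map KI euclideanreal L"
      "\<And>p. p \<in> KI_box \<Longrightarrow> L (KI_cover p) = \<theta> p"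
      by (rule quotient_map_lift_exists[OF quotient_map_KI_cover cont])
        (unfold topspace_euclidean_subtopology, blast intro: fibre, blast)
    have "h x = cis (L x)" if x: "x \<in> topspace KI" for x
    proof -
      have "x \<in> KI_cover ` KI_box"
        using x quotient_imp_surjective_map[OF quotient_map_KI_cover] by simp
      then obtain p where "p \<in> KI_box" "x = KI_cover p" by blast
      then show ?thesis using L(2) \<theta>(2) by fastforce
    qed
    with L(1) show ?thesis by blast
  qed
  show ?thesis
  proof (rule exI[of _ k], intro conjI allI impI, goal_cases)
    case 1
    show ?case by (rule angles)
  next
    case 2
    then show ?case by (rule lift)
  qed
qed

section \<open>Sapphires\<close>

locale sapphire =
  fixes A :: "int^2^2" and \<phi>
  assumes gluing: "sapphire_gluing A \<phi>"
begin

definition incl :: "nat \<Rightarrow> (complex \<times> complex \<times> real) set \<Rightarrow> (nat \<times> (complex \<times> complex \<times> real) set) set" where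
  "incl i x = attach_rel \<phi> KI KI_boundary `` {(i, x)}"

lemma homeomorphic_map_boundary:
  "homeomorphic_map (subtopology KI KI_boundary) (subtopology KI KI_boundary) \<phi>"
  using gluing by (simp add: sapphire_gluing_def)

lemma topspace_boundary: "topspace (subtopology KI KI_boundary) = KI_boundary"
  using KI_boundary_subset by (simp add: Int_absorb1)

lemma image_boundary: "\<phi> ` KI_boundary = KI_boundary"
  using homeomorphic_imp_surjective_map[OF homeomorphic_map_boundary] by (simp only: topspace_boundary)

lemma inj_on_boundary: "inj_on \<phi> KI_boundary"
  using homeomorphic_imp_injective_map[OF homeomorphic_map_boundary] by (simp only: topspace_boundary)

section \<open>The glued space and its two pieces\<close>

lemma quotient_map_sapphire:
  "quotient_map (sum_topology (\<lambda>_. KI) {1, 2}) (sapphire_space \<phi>) (\<lambda>(i, x). incl i x)"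
  using quotient_map_quotient_topology[of "sum_topology (\<lambda>_. KI) {1, 2}" "attach_rel \<phi> KI KI_boundary"]
  by (simp add: sapphire_space_def incl_def case_prod_unfold)

lemma continuous_map_incl:
  assumes "i \<in> {1, 2}"
  shows "continuous_map KI (sapphire_space \<phi>) (incl i)"
  using continuous_map_compose[OF continuous_map_component_injection[OF assms]
      quotient_imp_continuous_map[OF quotient_map_sapphire]]
  by (simp add: o_def)

lemma topspace_sapphire: "topspace (sapphire_space \<phi>) = incl 1 ` topspace KI \<union> incl 2 ` topspace KI"
proof -
  have "topspace (sapphire_space \<phi>) = (\<lambda>(i, x). incl i x) ` ({1, 2} \<times> topspace KI)"
    using quotient_imp_surjective_map[OF quotient_map_sapphire] by simp
  also have "\<dots> = incl 1 ` topspace KI \<union> incl 2 ` topspace KI"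
    by auto
  finally show ?thesis .
qed

lemma incl_eq_iff:
  assumes "i \<in> {1, 2}" "j \<in> {1, 2}" "x \<in> topspace KI" "y \<in> topspace KI"
  shows "incl i x = incl j y \<longleftrightarrow> ((i, x), (j, y)) \<in> attach_rel \<phi> KI KI_boundary"
  unfolding incl_def
  using eq_equiv_class_iff[OF equiv_attach_rel[OF KI_boundary_subset inj_on_boundary]] assms
    image_boundary KI_boundary_subset by simp

lemma incl_glue:
  assumes "x \<in> KI_boundary"
  shows "incl 1 (\<phi> x) = incl 2 x"
  using assms image_boundary KI_boundary_subset by (subst incl_eq_iff) (auto simp: attach_rel_def)

text \<open>Both pieces are connected and they meet along the nonempty gluing torus.\<close>

lemma connected_space_sapphire: "connected_space (sapphire_space \<phi>)"
proof -
  have "connectedin (sapphire_space \<phi>) (incl i ` topspace KI)" if "i \<in> {1, 2}" for i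
    using continuous_map_incl[OF that] connected_space_KI
    by (metis connectedin_continuous_map_image connectedin_topspace)
  moreover have "incl 1 ` topspace KI \<inter> incl 2 ` topspace KI \<noteq> {}"
  proof -
    obtain x where x: "x \<in> KI_boundary" using KI_boundary_nonempty by blast
    then have "\<phi> x \<in> topspace KI" "x \<in> topspace KI"
      using image_boundary KI_boundary_subset by auto
    then show ?thesis using incl_glue[OF x] by blast
  qed
  ultimately have "connectedin (sapphire_space \<phi>) (topspace (sapphire_space \<phi>))"
    unfolding topspace_sapphire by (intro connectedin_Un) auto
  then show ?thesis by (simp add: connectedin_topspace)
qed

lemma topspace_sapphire_nonempty: "topspace (sapphire_space \<phi>) \<noteq> {}"
  using KI_boundary_subset KI_boundary_nonempty unfolding topspace_sapphire by blast

text \<open>Restricting \<open>h\<close> to the pieces gives integers \<open>k1\<close> and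
  \<open>k2\<close>. The gluing forces both to vanish, so each piece has an angle, and a shift by a
  multiple of 2 pi makes the two agree on the common torus.\<close>

lemma angle_sapphire:
  assumes nz: "A $ 1 $ 1 \<noteq> 0" "A $ 2 $ 1 \<noteq> 0"
    and h: "continuous_map (sapphire_space \<phi>) euclidean h"
      "\<And>x. x \<in> topspace (sapphire_space \<phi>) \<Longrightarrow> norm (h x) = 1"
  shows "\<exists>L. continuous_map (sapphire_space \<phi>) euclideanreal L \<and>
    (\<forall>x\<in>topspace (sapphire_space \<phi>). h x = cis (L x))"
proof -
  let ?h1 = "h \<circ> incl 1" and ?h2 = "h \<circ> incl 2"
  have c: "continuous_map KI euclidean ?h1" "continuous_map KI euclidean ?h2"
    using continuous_map_compose[OF continuous_map_incl h(1)] by auto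
  have norm1: "\<And>x. x \<in> topspace KI \<Longrightarrow> norm (?h1 x) = 1" "\<And>x. x \<in> topspace KI \<Longrightarrow> norm (?h2 x) = 1"
    using h(2) by (auto simp: topspace_sapphire)
  obtain k1 :: int where k1: "\<And>m n. \<exists>u. continuous_on {0..1} u \<and>
      (\<forall>s\<in>{0..1}. ?h1 (boundary_loop m n s) = cis (u s)) \<and> u 1 - u 0 = 4 * pi * of_int k1 * of_int m"
    "k1 = 0 \<Longrightarrow> \<exists>L. continuous_map KI euclideanreal L \<and> (\<forall>x\<in>topspace KI. ?h1 x = cis (L x))"
    using KI_circle_map[OF c(1) norm1(1)] by blast
  obtain k2 :: int where k2: "\<And>m n. \<exists>u. continuous_on {0..1} u \<and>
      (\<forall>s\<in>{0..1}. ?h2 (boundary_loop m n s) = cis (u s)) \<and> u 1 - u 0 = 4 * pi * of_int k2 * of_int m"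
    "k2 = 0 \<Longrightarrow> \<exists>L. continuous_map KI euclideanreal L \<and> (\<forall>x\<in>topspace KI. ?h2 x = cis (L x))"
    using KI_circle_map[OF c(2) norm1(2)] by blast
  \<comment> \<open>A boundary loop of the second piece and its image under \<phi> are the same loop
    in the sapphire. Its degree is \<open>2 * k2 * m\<close> seen from the second piece and
    \<open>2 * k1 * m'\<close> seen from the first.\<close>
  have deg: "k2 * m = k1 * m'"
    if hom: "freely_homotopic_loops (subtopology KI KI_boundary) (\<phi> \<circ> boundary_loop m n) (boundary_loop m' n')"
    for m n m' n'
  proof -
    obtain u where u: "continuous_on {0..1} u" "\<And>s. s \<in> {0..1} \<Longrightarrow> ?h2 (boundary_loop m n s) = cis (u s)"
      "u 1 - u 0 = 4 * pi * of_int k2 * of_int m" using k2(1) by metis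
    obtain v where v: "continuous_on {0..1} v" "\<And>s. s \<in> {0..1} \<Longrightarrow> ?h1 (boundary_loop m' n' s) = cis (v s)"
      "v 1 - v 0 = 4 * pi * of_int k1 * of_int m'" using k1(1) by metis
    have "boundary_loop m n s \<in> KI_boundary" for s
      by (auto simp: boundary_loop_eq KI_boundary_eq)
    then have "?h1 ((\<phi> \<circ> boundary_loop m n) s) = cis (u s)" if "s \<in> {0..1}" for s
      using u(2)[OF that] incl_glue by simp
    then have "u 1 - u 0 = v 1 - v 0"
      using freely_homotopic_loops_angle[OF hom continuous_map_from_subtopology[OF c(1)] _ u(1) _ v(1,2)]
        norm1(1) by simp
    then have "real_of_int (k2 * m) = real_of_int (k1 * m')"
      using u(3) v(3) by simp
    then show ?thesis by (simp only: of_int_eq_iff)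
  qed
  \<comment> \<open>The two equations come from the images of alpha_2 and beta_2. The second is 0 =
    k1 t and gives \<open>k1 = 0\<close>; then the first gives \<open>k2 = 0\<close>.\<close>
  have "k2 * 1 = k1 * A $ 1 $ 1" "k2 * 0 = k1 * A $ 2 $ 1"
    using deg gluing unfolding sapphire_gluing_def by blast+
  with nz have "k1 = 0" "k2 = 0" by auto
  then obtain L1 L2 where L1: "continuous_map KI euclideanreal L1" "\<And>x. x \<in> topspace KI \<Longrightarrow> ?h1 x = cis (L1 x)"
    and L2: "continuous_map KI euclideanreal L2" "\<And>x. x \<in> topspace KI \<Longrightarrow> ?h2 x = cis (L2 x)"
    using k1(2) k2(2) by metis
  have "continuous_map (subtopology KI KI_boundary) euclideanreal (L1 \<circ> \<phi>)"
    by (rule continuous_map_compose[OF homeomorphic_imp_continuous_map[OF homeomorphic_map_boundary]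
          continuous_map_from_subtopology[OF L1(1)]])
  moreover have "cis ((L1 \<circ> \<phi>) x) = cis (L2 x)" if "x \<in> KI_boundary" for x
  proof -
    have "\<phi> x \<in> topspace KI" "x \<in> topspace KI"
      using that image_boundary KI_boundary_subset by auto
    then show ?thesis
      using L1(2) L2(2) incl_glue[OF that] by (metis comp_apply)
  qed
  moreover have "connected_space (subtopology KI KI_boundary)"
    using connectedin_KI_boundary by (simp add: connectedin_def)
  ultimately obtain d :: int where d: "\<And>x. x \<in> KI_boundary \<Longrightarrow> L1 (\<phi> x) = L2 x + 2 * pi * d"
    using angles_differ_by_constant[OF _ _ continuous_map_from_subtopology[OF L2(1)], of KI_boundary "L1 \<circ> \<phi>"]
      topspace_boundary by auto
  \<comment> \<open>Adding \<open>2 * pi * d\<close> on the second piece matches the angles across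
    the gluing; since \<open>d\<close> is an integer, \<open>cis\<close> does not see the
    shift.\<close>
  define g where "g = (\<lambda>(i::nat, x). if i = 1 then L1 x else L2 x + 2 * pi * d)"
  have cont: "continuous_map (sum_topology (\<lambda>_. KI) {1, 2}) euclideanreal g"
    unfolding continuous_map
  proof (intro conjI allI impI)
    fix U :: "real set" assume U: "openin euclideanreal U"
    have "continuous_map KI euclideanreal (\<lambda>x. g (i, x))" if "i \<in> {1, 2}" for i
      using that L1(1) L2(1) by (auto simp: g_def intro!: continuous_intros)
    then have "openin KI {x \<in> topspace KI. g (i, x) \<in> U}" if "i \<in> {1, 2}" for i
      using openin_continuous_map_preimage[OF _ U] that by blast
    then show "openin (sum_topology (\<lambda>_. KI) {1, 2}) {x \<in> topspace (sum_topology (\<lambda>_. KI) {1, 2}). g x \<in> U}"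
      by (auto simp: openin_sum_topology)
  qed auto
  have fibre: "g (i, x) = g (j, y)"
    if "i \<in> {1, 2}" "j \<in> {1, 2}" "x \<in> topspace KI" "y \<in> topspace KI" "incl i x = incl j y" for i j x y
    using that(5) d unfolding incl_eq_iff[OF that(1-4)] by (auto simp: attach_rel_def g_def)
  have "g p = g q"
    if "p \<in> topspace (sum_topology (\<lambda>_. KI) {1, 2})" "q \<in> topspace (sum_topology (\<lambda>_. KI) {1, 2})"
      "(\<lambda>(i, x). incl i x) p = (\<lambda>(i, x). incl i x) q" for p q
    using that fibre[of "fst p" "fst q" "snd p" "snd q"] by (simp add: mem_Times_iff case_prod_unfold)
  then obtain L where L: "continuous_map (sapphire_space \<phi>) euclideanreal L"
    "\<And>p. p \<in> topspace (sum_topology (\<lambda>_. KI) {1, 2}) \<Longrightarrow> L ((\<lambda>(i, x). incl i x) p) = g p"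
    using quotient_map_lift_exists[OF quotient_map_sapphire cont] by metis
  have L_incl: "L (incl i x) = g (i, x)" if "i \<in> {1, 2}" "x \<in> topspace KI" for i x
    using L(2)[of "(i, x)"] that by simp
  have "h (incl 1 x) = cis (L (incl 1 x))" "h (incl 2 x) = cis (L (incl 2 x))"
    if "x \<in> topspace KI" for x
  proof -
    show "h (incl 1 x) = cis (L (incl 1 x))"
      using L_incl[of 1 x] L1(2)[OF that] that by (simp add: g_def)
    have "cis (2 * pi * d) = 1" by (rule cis_multiple_2pi) simp
    then show "h (incl 2 x) = cis (L (incl 2 x))"
      using L_incl[of 2 x] L2(2)[OF that] that by (simp add: g_def cis_mult[symmetric])
  qed
  with L(1) show ?thesis
    by (auto simp: topspace_sapphire)
qed

end

section \<open>The Borsuk-Ulam property\<close>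

text \<open>For a CW complex this says that the first integral cohomology group vanishes, since that
  group classifies maps to the circle up to homotopy.\<close>

definition circle_maps_have_angles :: "'a topology \<Rightarrow> bool" where
  "circle_maps_have_angles X \<longleftrightarrow>
    (\<forall>h. continuous_map X euclidean h \<and> (\<forall>x\<in>topspace X. norm (h x) = 1) \<longrightarrow>
      (\<exists>L. continuous_map X euclideanreal L \<and> (\<forall>x\<in>topspace X. h x = cis (L x))))"

text \<open>An angle of \<open>h \<circ> g\<close> pulled back along the inverse \<open>f\<close> of
  \<open>g\<close> is an angle of \<open>h\<close>. This carries the property from the glued model
  to a manifold that is only homeomorphic to it.\<close>

lemma circle_maps_have_angles_homeomorphic:
  assumes "X homeomorphic_space Y" "circle_maps_have_angles Y"
  shows "circle_maps_have_angles X"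
  unfolding circle_maps_have_angles_def
proof (intro allI impI, elim conjE)
  fix h :: "'a \<Rightarrow> complex"
  assume h: "continuous_map X euclidean h" "\<forall>x\<in>topspace X. norm (h x) = 1"
  obtain f g where f: "continuous_map X Y f" and g: "continuous_map Y X g"
    and gf: "\<And>x. x \<in> topspace X \<Longrightarrow> g (f x) = x"
    using assms(1) unfolding homeomorphic_space_def homeomorphic_maps_def by blast
  have "continuous_map Y euclidean (h \<circ> g)"
    using g h(1) by (rule continuous_map_compose)
  moreover have "\<forall>y\<in>topspace Y. norm ((h \<circ> g) y) = 1"
    using h(2) continuous_map_image_subset_topspace[OF g] by auto
  ultimately obtain L where L: "continuous_map Y euclideanreal L" "\<forall>y\<in>topspace Y. (h \<circ> g) y = cis (L y)"
    using assms(2) unfolding circle_maps_have_angles_def by blast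
  have "h x = cis ((L \<circ> f) x)" if "x \<in> topspace X" for x
    using L(2) gf[OF that] continuous_map_image_subset_topspace[OF f] that by force
  with continuous_map_compose[OF f L(1)]
  show "\<exists>L. continuous_map X euclideanreal L \<and> (\<forall>x\<in>topspace X. h x = cis (L x))"
    by blast
qed

lemma Borsuk_Ulam_plane:
  fixes X :: "'a topology"
  assumes X: "connected_space X" "topspace X \<noteq> {}" "circle_maps_have_angles X"
    and \<tau>: "continuous_map X X \<tau>" "\<And>x. x \<in> topspace X \<Longrightarrow> \<tau> (\<tau> x) = x"
  shows "Borsuk_Ulam_property X \<tau> (euclidean :: (real^2) topology)"
  unfolding Borsuk_Ulam_property_def
proof (intro allI impI, rule ccontr)
  fix f :: "'a \<Rightarrow> real^2"
  assume f: "continuous_map X euclidean f" and "\<not> (\<exists>x\<in>topspace X. f x = f (\<tau> x))"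
  then have ne: "f x \<noteq> f (\<tau> x)" if "x \<in> topspace X" for x
    using that by blast
  define e where "e x = f x - f (\<tau> x)" for x
  \<comment> \<open>The plane is read as the complex numbers so that the normalized difference is a
    circle-valued map to which the angle property applies.\<close>
  define z where "z x = Complex (e x $ 1) (e x $ 2)" for x
  define h where "h x = z x / norm (z x)" for x
  have \<tau>_in: "\<tau> x \<in> topspace X" if "x \<in> topspace X" for x
    using that continuous_map_image_subset_topspace[OF \<tau>(1)] by auto
  have z_nz: "z x \<noteq> 0" if "x \<in> topspace X" for x
    using ne[OF that] by (auto simp: z_def e_def complex_eq_iff vec_eq_iff forall_2)
  have "continuous_map X euclidean (f \<circ> \<tau>)"
    by (rule continuous_map_compose[OF \<tau>(1) f])
  then have "continuous_map X euclidean e"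
    unfolding e_def using f by (auto intro!: continuous_intros simp: o_def)
  moreover have "continuous_map euclidean euclidean (\<lambda>v::real^2. Complex (v $ 1) (v $ 2))"
    by (auto simp: Complex_eq intro!: continuous_intros)
  ultimately have "continuous_map X euclidean ((\<lambda>v. Complex (v $ 1) (v $ 2)) \<circ> e)"
    by (rule continuous_map_compose)
  moreover have "(\<lambda>v. Complex (v $ 1) (v $ 2)) \<circ> e = z"
    by (simp add: fun_eq_iff z_def)
  ultimately have "continuous_map X euclidean z" by simp
  then have "continuous_map X (top_of_set (- {0})) z"
    using z_nz by (auto simp: continuous_map_in_subtopology)
  moreover have "continuous_map (top_of_set (- {0})) euclidean (\<lambda>w::complex. w / norm w)"
    by (auto intro!: continuous_intros)
  ultimately have "continuous_map X euclidean ((\<lambda>w. w / norm w) \<circ> z)"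
    by (rule continuous_map_compose)
  moreover have "(\<lambda>w. w / norm w) \<circ> z = h"
    by (simp add: fun_eq_iff h_def)
  ultimately have "continuous_map X euclidean h" by simp
  moreover have "\<forall>x\<in>topspace X. norm (h x) = 1"
    using z_nz by (simp add: h_def norm_divide)
  ultimately obtain L where L: "continuous_map X euclideanreal L" "\<And>x. x \<in> topspace X \<Longrightarrow> h x = cis (L x)"
    using X(3)[unfolded circle_maps_have_angles_def, THEN spec[of _ h]] by metis
  have odd: "h (\<tau> x) = - h x" if "x \<in> topspace X" for x
  proof -
    have "z (\<tau> x) = - z x"
      using \<tau>(2)[OF that] by (simp add: z_def e_def complex_eq_iff)
    then show ?thesis by (simp add: h_def)
  qed
  define v where "v x = L (\<tau> x) - L x" for x
  have "continuous_map X euclideanreal (L \<circ> \<tau>)"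
    by (rule continuous_map_compose[OF \<tau>(1) L(1)])
  then have "continuous_map X euclideanreal v"
    unfolding v_def using L(1) by (auto intro!: continuous_intros simp: o_def)
  then have conn: "connected (v ` topspace X)"
    using connectedin_continuous_map_image[of X euclideanreal _ "topspace X"] X(1)
    by (simp add: connectedin_topspace)
  obtain x where x: "x \<in> topspace X" using X(2) by blast
  \<comment> \<open>Because \<tau> is an involution, \<open>v\<close> is odd under it. Its image is
    connected and contains both \<open>v x\<close> and \<open>- v x\<close>, hence also 0.\<close>
  have "v (\<tau> x) = - v x"
    using \<tau>(2)[OF x] by (simp add: v_def)
  then have "v x \<in> v ` topspace X" "- v x \<in> v ` topspace X"
    using x \<tau>_in[OF x] by (auto simp: image_iff) (metis)
  then have "0 \<in> v ` topspace X"
    using connectedD_interval[OF conn, of "v x" "- v x" 0] connectedD_interval[OF conn, of "- v x" "v x" 0]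
    by (cases "v x \<le> 0") auto
  then obtain y where y: "y \<in> topspace X" "L (\<tau> y) = L y"
    by (auto simp: v_def)
  then have "h (\<tau> y) = h y"
    using L(2) \<tau>_in by simp
  \<comment> \<open>Equal angles at \<open>y\<close> and \<open>\<tau> y\<close> give equal values
    of \<open>h\<close>, but these values are opposite; so \<open>h y\<close> would vanish although
    \<open>cis\<close> never does.\<close>
  with odd[OF y(1)] have "h y = 0"
    by (simp add: complex_eq_iff)
  with L(2)[OF y(1)] show False by simp
qed

theorem proposition4p1:
  fixes M :: "'a topology" and \<tau> :: "'a \<Rightarrow> 'a"
  assumes "sapphire_Sol_manifold M" and "free_involution M \<tau>"
  shows "Borsuk_Ulam_property M \<tau> (euclidean :: (real^2) topology)"
proof -
  obtain A :: "int^2^2" and \<phi> where A: "\<And>i j. A $ i $ j \<noteq> 0" and \<phi>: "sapphire_gluing A \<phi>"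
    and M: "M homeomorphic_space sapphire_space \<phi>"
    using assms(1) unfolding sapphire_Sol_manifold_def is_sapphire_def by blast
  interpret sapphire A \<phi> by unfold_locales (rule \<phi>)
  have "circle_maps_have_angles (sapphire_space \<phi>)"
    unfolding circle_maps_have_angles_def using angle_sapphire[OF A A] by blast
  then have "circle_maps_have_angles M"
    by (rule circle_maps_have_angles_homeomorphic[OF M])
  moreover have "connected_space M"
    using homeomorphic_connected_space[OF M] connected_space_sapphire by blast
  moreover have "topspace M \<noteq> {}"
    using homeomorphic_empty_space[OF M] topspace_sapphire_nonempty by auto
  moreover have "continuous_map M M \<tau>" "\<And>x. x \<in> topspace M \<Longrightarrow> \<tau> (\<tau> x) = x"
    using assms(2) by (auto simp: free_involution_def homeomorphic_imp_continuous_map)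
  ultimately show ?thesis
    by (intro Borsuk_Ulam_plane)
qed

end
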